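(* Fix $a<b$, $K\ge1$ and $\sigma>0$. The mixed regression model over $\bigcup_{x_0\in[a,b]}\mathcal{R}_{x_0}$ is identifiable: if $x_0,x_1\in[a,b]$, $(p_X,f,\{\lambda_k\}_{k=1}^K,\{m_k\}_{k=1}^K)\in\mathcal{R}_{x_0}$, $(q_X,g,\{\pi_k\}_{k=1}^K,\{\mu_k\}_{k=1}^K)\in\mathcal{R}_{x_1}$ and $$p_X(x)\sum_{k=1}^K\lambda_kf(y-m_k(x))=q_X(x)\sum_{k=1}^K\pi_kg(y-\mu_k(x))\qquad\text{for all }(x,y)\in[a,b]\times\mathbb{R},$$ then $p_X=q_X$, $f=g$, and there is a permutation $\Pi$ of $\{1,\dots,K\}$ such that $\pi_k=\lambda_{\Pi(k)}$ and $\mu_k=m_{\Pi(k)}$ on $[a,b]$ for every $k$.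
   Context: $\phi_\sigma$ is the density of $\mathcal{N}(0,\sigma^2)$; $(\phi_\sigma\ast G)(y)=\int\phi_\sigma(y-\theta)\,dG(\theta)$ for a probability measure $G$ on $\mathbb{R}$. For $x_0\in[a,b]$, $\mathcal{R}_{x_0}$ is the set of tuples $(p_X,f,\{\lambda_k\}_{k=1}^K,\{m_k\}_{k=1}^K)$ with $p_X$ a probability density on $[a,b]$ with $\inf_{[a,b]}p_X>0$, $f$ a probability density on $\mathbb{R}$ with $\int yf(y)\,dy=0$, $\min_k\lambda_k>0$, $\sum_k\lambda_k=1$, $m_k$ continuous on $[a,b]$, and such that: (A1) $f=\phi_\sigma\ast G_0$ for some compactly supported probability measure $G_0$; (A2) $\min_{j\ne k}|\lambda_j-\lambda_k|>0$; (A3) $\min_{j\ne k}|m_j(x_0)-m_k(x_0)|>2\operatorname{diam}(\operatorname{supp}(G_0))$; (A4) $\{x\in[a,b]:\exists\, j\ne k,\ m_j(x)=m_k(x)\}$ is countable. The number $\sigma$ is fixed and common to all members of all these classes. *)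

theory Defs
  imports "HOL-Probability.Probability"
begin

definition measure_support :: "'a::topological_space measure \<Rightarrow> 'a set" where
  "measure_support G = {x. \<forall>U. open U \<and> x \<in> U \<longrightarrow> emeasure G U > 0}"

definition compactly_supported_prob :: "real measure \<Rightarrow> bool" where
  "compactly_supported_prob G \<longleftrightarrow>
     prob_space G \<and> sets G = sets borel \<and> compact (measure_support G)"

definition gauss_conv :: "real \<Rightarrow> real measure \<Rightarrow> real \<Rightarrow> real" where
  "gauss_conv \<sigma> G y = (LINT \<theta>|G. normal_density 0 \<sigma> (y - \<theta>))"

text \<open>A probability density on a set is a total function of which only the values on
  that set matter. Integrability is stated explicitly because the Bochner integral of
  a non-integrable function is 0 by convention. Lebesgue measurability is required,
  so all Borel densities are included.\<close>

definition prob_density_on :: "real set \<Rightarrow> (real \<Rightarrow> real) \<Rightarrow> bool" where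
  "prob_density_on S p \<longleftrightarrow>
     (\<forall>x\<in>S. 0 \<le> p x) \<and> set_integrable lebesgue S p \<and> (LINT x:S|lebesgue. p x) = 1"

text \<open>The class of parameter tuples at the point \<open>x0\<close>. Families indexed by
  \<open>1, \<dots>, K\<close> are functions on \<^typ>\<open>nat\<close> of which only the values on \<open>{1..K}\<close> matter.
  The minima are written as bounds for every (pair of distinct) index, so the
  conditions over \<open>j \<noteq> k\<close> are vacuous for \<open>K = 1\<close> (minimum over the empty set being
  infinite). The mixing measure \<open>G0\<close> is the same in the representation of \<open>f\<close>
  and in the separation condition at \<open>x0\<close>.\<close>

definition regression_class ::
  "real \<Rightarrow> real \<Rightarrow> nat \<Rightarrow> real \<Rightarrow> real \<Rightarrow>
    ((real \<Rightarrow> real) \<times> (real \<Rightarrow> real) \<times> (nat \<Rightarrow> real) \<times> (nat \<Rightarrow> real \<Rightarrow> real)) set" where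
  "regression_class a b K \<sigma> x0 =
    {(p, f, w, m).
       prob_density_on {a..b} p \<and> (INF x\<in>{a..b}. p x) > 0 \<and>
       prob_density_on UNIV f \<and>
       integrable lebesgue (\<lambda>y. y * f y) \<and> (LINT y|lebesgue. y * f y) = 0 \<and>
       (\<forall>k\<in>{1..K}. w k > 0) \<and> (\<Sum>k=1..K. w k) = 1 \<and>
       (\<forall>k\<in>{1..K}. continuous_on {a..b} (m k)) \<and>
       (\<exists>G0. compactly_supported_prob G0 \<and> f = gauss_conv \<sigma> G0 \<and>
          (\<forall>j\<in>{1..K}. \<forall>k\<in>{1..K}. j \<noteq> k \<longrightarrow>
             \<bar>m j x0 - m k x0\<bar> > 2 * diameter (measure_support G0))) \<and>
       (\<forall>j\<in>{1..K}. \<forall>k\<in>{1..K}. j \<noteq> k \<longrightarrow> \<bar>w j - w k\<bar> > 0) \<and>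
       countable {x\<in>{a..b}. \<exists>j\<in>{1..K}. \<exists>k\<in>{1..K}. j \<noteq> k \<and> m j x = m k x}}"

end

theory Submission
  imports Defs
begin

text \<open>
  The Fourier transform of a Gaussian has no zeros, so equality of the two mixtures of
  \<open>f = \<phi>\<^sub>\<sigma> * G\<close> and \<open>g = \<phi>\<^sub>\<sigma> * H\<close> means equality of the corresponding mixtures of translates of
  \<open>G\<close> and \<open>H\<close>. If the support of \<open>G\<close> is at least as wide as that of \<open>H\<close>, then at \<open>x0\<close> the
  clusters \<open>m k x0 + supp G\<close> lie further apart than the diameter of \<open>supp H\<close>, so every translate
  \<open>\<mu> k x0 + supp H\<close> lies in a single cluster. There are equally many clusters and translates,
  which gives a bijection; weights agree along it and \<open>G\<close>, \<open>H\<close> agree up to translation, hence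
  \<open>f = g\<close> because both are centred. Once the error is common it can be cancelled at
  every \<open>x\<close>, leaving equality of two atomic measures. Off the countable set of crossings the
  distinct weights identify the atoms, and continuity covers the crossings.
\<close>

subsection \<open>Deconvolution\<close>

lemma real_distributionI: "prob_space G \<Longrightarrow> sets G = sets borel \<Longrightarrow> real_distribution G"
  by (simp add: real_distribution_def real_distribution_axioms_def)

lemma borel_measurable_gauss_conv:
  assumes "real_distribution G"
  shows "gauss_conv \<sigma> G \<in> borel_measurable borel"
proof -
  interpret G: real_distribution G by fact
  show ?thesis
    unfolding gauss_conv_def[abs_def] normal_density_def by measurable
qed

section \<open>Fourier transforms of Gaussian convolutions\<close>

lemma Fourier_normal_density:
  assumes "\<sigma> > 0"
  shows "(CLINT y|lborel. iexp (t * y) * normal_density 0 \<sigma> y) = exp (- (\<sigma> * t)\<^sup>2 / 2)"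
proof -
  \<comment> \<open>Rescaling by \<open>\<sigma>\<close> reduces the claim to the characteristic
    function of the standard normal law at \<open>\<sigma> * t\<close>.\<close>
  have "(CLINT y|lborel. iexp (t * y) * normal_density 0 \<sigma> y)
      = \<bar>\<sigma>\<bar> *\<^sub>R (CLINT y|lborel. iexp (t * (0 + \<sigma> * y)) * normal_density 0 \<sigma> (0 + \<sigma> * y))"
    using assms by (intro lborel_integral_real_affine) simp
  also have "\<dots> = (CLINT y|lborel. std_normal_density y *\<^sub>R iexp (\<sigma> * t * y))"
    unfolding integral_scaleR_right[symmetric]
    using assms
    by (intro Bochner_Integration.integral_cong)
       (auto simp: normal_density_def real_sqrt_mult power_mult_distrib scaleR_conv_of_real algebra_simps)
  also have "\<dots> = char std_normal_distribution (\<sigma> * t)"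
    unfolding char_def by (subst integral_density) (auto simp: normal_density_nonneg)
  also have "\<dots> = exp (- (\<sigma> * t)\<^sup>2 / 2)"
    by (simp add: char_std_normal_distribution)
  finally show ?thesis .
qed

lemma integrable_iexp_normal_density:
  assumes "\<sigma> > 0"
  shows "integrable lborel (\<lambda>y. iexp (t * y) * normal_density \<mu> \<sigma> y)"
proof (rule Bochner_Integration.integrable_bound)
  show "integrable lborel (normal_density \<mu> \<sigma>)"
    using assms by simp
qed (auto simp: norm_mult)

text \<open>Fubini lets the \<open>y\<close>-integral be taken first; for fixed
  \<open>\<theta>\<close> a shift of variable splits off the factor
  \<open>iexp (t * \<theta>)\<close>, whose average over \<open>P\<close> is the characteristic
  function.\<close>

lemma Fourier_gauss_conv:
  assumes "real_distribution P" "\<sigma> > 0"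
  shows "(CLINT y|lborel. iexp (t * y) * gauss_conv \<sigma> P y) = of_real (exp (- (\<sigma> * t)\<^sup>2 / 2)) * char P t"
proof -
  interpret P: real_distribution P by fact
  interpret PL: pair_sigma_finite P lborel ..
  let ?F = "\<lambda>\<theta> y. iexp (t * y) * normal_density 0 \<sigma> (y - \<theta>)"
  have shift: "normal_density 0 \<sigma> (y - \<theta>) = normal_density \<theta> \<sigma> y" for y \<theta>
    by (simp add: normal_density_def)
  have [measurable]: "case_prod ?F \<in> borel_measurable (P \<Otimes>\<^sub>M lborel)"
    unfolding normal_density_def by measurable
  have int: "integrable (P \<Otimes>\<^sub>M lborel) (case_prod ?F)"
  proof (rule PL.Fubini_integrable)
    \<comment> \<open>\<open>iexp\<close> has modulus 1, so only a normal density centred at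
      \<open>\<theta>\<close> is left.\<close>
    have "(LINT y|lborel. norm (?F \<theta> y)) = 1" for \<theta>
      using assms(2) by (simp add: norm_mult shift del: of_real_mult)
    then show "integrable P (\<lambda>\<theta>. LINT y|lborel. norm (case_prod ?F (\<theta>, y)))"
      by simp
    show "AE \<theta> in P. integrable lborel (\<lambda>y. case_prod ?F (\<theta>, y))"
      using integrable_iexp_normal_density[OF assms(2)] by (simp add: shift)
  qed simp
  have inner: "(CLINT y|lborel. ?F \<theta> y) = of_real (exp (- (\<sigma> * t)\<^sup>2 / 2)) * iexp (t * \<theta>)" for \<theta>
  proof -
    have "(CLINT y|lborel. ?F \<theta> y) = (CLINT y|lborel. ?F \<theta> (\<theta> + y))"
      using lborel_integral_real_affine[of 1 "?F \<theta>" \<theta>] by simp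
    also have "\<dots> = (CLINT y|lborel. iexp (t * \<theta>) * (iexp (t * y) * normal_density 0 \<sigma> y))"
      by (intro Bochner_Integration.integral_cong) (auto simp: exp_add algebra_simps)
    finally show ?thesis
      using Fourier_normal_density[OF assms(2)] by simp
  qed
  have "(CLINT y|lborel. iexp (t * y) * gauss_conv \<sigma> P y) = (CLINT y|lborel. CLINT \<theta>|P. ?F \<theta> y)"
    by (simp add: gauss_conv_def)
  also have "\<dots> = (CLINT \<theta>|P. CLINT y|lborel. ?F \<theta> y)"
    using int by (rule PL.Fubini_integral)
  also have "\<dots> = (CLINT \<theta>|P. of_real (exp (- (\<sigma> * t)\<^sup>2 / 2)) * iexp (t * \<theta>))"
    by (simp only: inner)
  finally show ?thesis
    by (simp add: char_def)
qed

text \<open>The Gaussian factor in the transform never vanishes and can be cancelled, so the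
  characteristic functions agree and Levy's theorem applies.\<close>

lemma gauss_conv_inject:
  assumes "real_distribution P" "real_distribution Q" "\<sigma> > 0"
    and "gauss_conv \<sigma> P = gauss_conv \<sigma> Q"
  shows "P = Q"
proof (rule Levy_uniqueness)
  have "char P t = char Q t" for t
    using Fourier_gauss_conv[of P \<sigma> t] Fourier_gauss_conv[of Q \<sigma> t] assms
    by simp
  then show "char P = char Q" ..
qed (use assms in auto)

text \<open>The law of a random location plus an independent error with law \<open>G\<close>. As the
  image of a product measure it is a probability measure at once, and Fubini computes its
  integrals.\<close>

definition mixture :: "'i set \<Rightarrow> ('i \<Rightarrow> real) \<Rightarrow> ('i \<Rightarrow> real) \<Rightarrow> real measure \<Rightarrow> real measure" where
  "mixture I w m G = distr (point_measure I w \<Otimes>\<^sub>M G) borel (\<lambda>(i, \<theta>). m i + \<theta>)"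

context
  fixes I :: "'i set" and w m :: "'i \<Rightarrow> real" and G :: "real measure"
  assumes I: "finite I" and w: "\<And>i. i \<in> I \<Longrightarrow> 0 \<le> w i" "(\<Sum>i\<in>I. w i) = 1"
    and G: "real_distribution G"
begin

interpretation G: real_distribution G by (rule G)

lemma prob_space_weights: "prob_space (point_measure I w)"
  using I w by (intro prob_spaceI) (simp add: emeasure_point_measure_finite space_point_measure sum_ennreal)

interpretation W: prob_space "point_measure I w" by (rule prob_space_weights)
interpretation WG: pair_prob_space "point_measure I w" G ..

lemma measurable_mixture_map [measurable]:
  "(\<lambda>(i, \<theta>). m i + \<theta>) \<in> borel_measurable (point_measure I w \<Otimes>\<^sub>M G)"
proof -
  have "m \<in> borel_measurable (point_measure I w)"
    by simp
  then show ?thesis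
    by measurable
qed

lemma real_distribution_mixture: "real_distribution (mixture I w m G)"
  unfolding mixture_def by (intro real_distributionI WG.prob_space_distr) auto

lemma integral_mixture:
  fixes h :: "real \<Rightarrow> 'b::{banach, second_countable_topology}"
  assumes [measurable]: "h \<in> borel_measurable borel" and B: "\<And>x. norm (h x) \<le> B"
  shows "integral\<^sup>L (mixture I w m G) h = (\<Sum>i\<in>I. w i *\<^sub>R (LINT \<theta>|G. h (m i + \<theta>)))"
proof -
  have meas: "(\<lambda>(i, \<theta>). h (m i + \<theta>)) \<in> borel_measurable (point_measure I w \<Otimes>\<^sub>M G)"
    using measurable_compose[OF measurable_mixture_map assms(1)] by (simp add: case_prod_beta')
  have int: "integrable (point_measure I w \<Otimes>\<^sub>M G) (\<lambda>(i, \<theta>). h (m i + \<theta>))"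
    using meas B by (intro WG.P.integrable_const_bound[of _ B]) auto
  have "integral\<^sup>L (mixture I w m G) h
      = integral\<^sup>L (point_measure I w \<Otimes>\<^sub>M G) (\<lambda>(i, \<theta>). h (m i + \<theta>))"
    unfolding mixture_def by (subst integral_distr) (auto simp: case_prod_beta')
  also have "\<dots> = (LINT i|point_measure I w. LINT \<theta>|G. h (m i + \<theta>))"
    by (rule WG.integral_fst[OF int, symmetric])
  finally show ?thesis
    using I w by (simp add: lebesgue_integral_point_measure_finite)
qed

lemma measure_mixture:
  assumes [measurable]: "E \<in> sets borel"
  shows "measure (mixture I w m G) E = (\<Sum>i\<in>I. w i * measure G {\<theta>. m i + \<theta> \<in> E})"
proof -
  interpret M: real_distribution "mixture I w m G"
    by (rule real_distribution_mixture)
  have "measure (mixture I w m G) E = (LINT x|mixture I w m G. indicator E x)"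
    using assms by simp
  also have "\<dots> = (\<Sum>i\<in>I. w i * (LINT \<theta>|G. indicator E (m i + \<theta>)))"
    by (subst integral_mixture[of _ 1]) auto
  also have "\<dots> = (\<Sum>i\<in>I. w i * measure G {\<theta>. m i + \<theta> \<in> E})"
  proof (intro sum.cong refl)
    fix i
    have "(LINT \<theta>|G. indicator E (m i + \<theta>) :: real) = (LINT \<theta>|G. indicator {\<theta>. m i + \<theta> \<in> E} \<theta>)"
      by (intro Bochner_Integration.integral_cong) (auto simp: indicator_def)
    then show "w i * (LINT \<theta>|G. indicator E (m i + \<theta>)) = w i * measure G {\<theta>. m i + \<theta> \<in> E}"
      by simp
  qed
  finally show ?thesis .
qed

lemma gauss_conv_mixture:
  assumes "\<sigma> > 0"
  shows "gauss_conv \<sigma> (mixture I w m G) y = (\<Sum>i\<in>I. w i * gauss_conv \<sigma> G (y - m i))"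
proof -
  \<comment> \<open>The peak of the Gaussian is the uniform bound that
    \<open>integral_mixture\<close> asks for.\<close>
  have "normal_density 0 \<sigma> (y - x) \<le> 1 / sqrt (2 * pi * \<sigma>\<^sup>2)" for x
    using assms by (auto simp: normal_density_def divide_simps)
  then show ?thesis
    unfolding gauss_conv_def
    by (subst integral_mixture[of _ "1 / sqrt (2 * pi * \<sigma>\<^sup>2)"])
       (auto simp: normal_density_def diff_diff_eq)
qed

end

text \<open>Both sides of the density equation are Gaussian convolutions of mixtures, so injectivity
  equates the mixtures themselves; the conclusion evaluates them at \<open>E\<close>.\<close>

lemma deconvolution:
  assumes "finite I" "\<And>i. i \<in> I \<Longrightarrow> 0 \<le> w i" "(\<Sum>i\<in>I. w i) = 1"
    and "finite J" "\<And>j. j \<in> J \<Longrightarrow> 0 \<le> v j" "(\<Sum>j\<in>J. v j) = 1"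
    and "real_distribution G" "real_distribution H" "\<sigma> > 0"
    and "\<And>y. (\<Sum>i\<in>I. w i * gauss_conv \<sigma> G (y - m i)) = (\<Sum>j\<in>J. v j * gauss_conv \<sigma> H (y - n j))"
    and "E \<in> sets borel"
  shows "(\<Sum>i\<in>I. w i * measure G {\<theta>. m i + \<theta> \<in> E}) = (\<Sum>j\<in>J. v j * measure H {\<theta>. n j + \<theta> \<in> E})"
proof -
  have "mixture I w m G = mixture J v n H"
    using assms
    by (intro gauss_conv_inject[of _ _ \<sigma>] real_distribution_mixture ext) (auto simp: gauss_conv_mixture)
  then show ?thesis
    using assms measure_mixture[of I w G E m] measure_mixture[of J v H E n] by simp
qed

subsection \<open>Supports and matching of components\<close>

text \<open>The complement of the support is the union of all null open sets; by Lindelof countably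
  many of them suffice, so it is null.\<close>

lemma AE_measure_support:
  fixes M :: "'a::second_countable_topology measure"
  assumes "sets M = sets borel"
  shows "AE x in M. x \<in> measure_support M"
proof -
  let ?F = "{U. open U \<and> emeasure M U = 0}"
  obtain F' where F': "F' \<subseteq> ?F" "countable F'" "\<Union>F' = \<Union>?F"
    using Lindelof[of ?F] by blast
  have "U \<in> null_sets M" if "U \<in> F'" for U
    using that F'(1) assms by (auto intro!: null_setsI)
  then have "\<Union>F' \<in> null_sets M"
    using null_sets_UN'[of F' "\<lambda>U. U" M] F'(2) by simp
  moreover have "x \<in> \<Union>F'" if "x \<notin> measure_support M" for x
    using that unfolding F'(3) measure_support_def by auto
  ultimately show ?thesis
    by (intro AE_I') auto
qed

lemma measure_support_nonempty:
  assumes "real_distribution G"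
  shows "measure_support G \<noteq> {}"
proof
  interpret G: real_distribution G by fact
  assume "measure_support G = {}"
  then show False
    using AE_measure_support[of G] by simp
qed

lemma atoms_unique:
  fixes m n w v :: "'i \<Rightarrow> real"
  assumes G: "real_distribution G" and S: "compact (measure_support G)"
    and fin: "finite I" "finite J"
    and eq: "\<And>E. E \<in> sets borel \<Longrightarrow>
      (\<Sum>i\<in>I. w i * measure G {\<theta>. m i + \<theta> \<in> E}) = (\<Sum>j\<in>J. v j * measure G {\<theta>. n j + \<theta> \<in> E})"
  shows "(\<Sum>i | i \<in> I \<and> m i = z. w i) = (\<Sum>j | j \<in> J \<and> n j = z. v j)"
proof (rule ccontr)
  interpret G: real_distribution G by fact
  \<comment> \<open>The upper end of the support of \<open>G\<close> shifted by the largest atom that fails to cancel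
    carries mass that no other shift can compensate.\<close>
  define Z where "Z = m ` I \<union> n ` J"
  define c where "c z = (\<Sum>i | i \<in> I \<and> m i = z. w i) - (\<Sum>j | j \<in> J \<and> n j = z. v j)" for z
  have c0: "c z = 0" if "z \<notin> Z" for z
  proof -
    have "{i \<in> I. m i = z} = {}" "{j \<in> J. n j = z} = {}"
      using that by (auto simp: Z_def)
    then show ?thesis by (simp only: c_def sum.empty)
  qed
  have Z: "finite Z" using fin by (simp add: Z_def)
  \<comment> \<open>Indices sharing a location are merged, so that both mixtures become sums over
    the same finite set \<open>Z\<close> and can be subtracted.\<close>
  have group: "(\<Sum>i\<in>A. u i * measure G {\<theta>. l i + \<theta> \<in> E})
      = (\<Sum>z\<in>Z. (\<Sum>i | i \<in> A \<and> l i = z. u i) * measure G {\<theta>. z + \<theta> \<in> E})"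
    if "finite A" "l ` A \<subseteq> Z" for A u l and E :: "real set"
  proof -
    have "(\<Sum>i\<in>A. u i * measure G {\<theta>. l i + \<theta> \<in> E})
        = (\<Sum>z\<in>Z. \<Sum>i | i \<in> A \<and> l i = z. u i * measure G {\<theta>. l i + \<theta> \<in> E})"
      using that Z by (intro sum.group[symmetric])
    then show ?thesis
      by (simp add: sum_distrib_right)
  qed
  have zero: "(\<Sum>z\<in>Z. c z * measure G {\<theta>. z + \<theta> \<in> E}) = 0" if "E \<in> sets borel" for E
    using eq[OF that] group[OF fin(1), of m w E] group[OF fin(2), of n v E]
    by (simp add: c_def left_diff_distrib sum_subtractf Z_def)
  define Z' where "Z' = {z \<in> Z. c z \<noteq> 0}"
  assume "(\<Sum>i | i \<in> I \<and> m i = z. w i) \<noteq> (\<Sum>j | j \<in> J \<and> n j = z. v j)"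
  then have "c z \<noteq> 0" by (simp add: c_def)
  then have ne: "finite Z'" "Z' \<noteq> {}"
    using c0 Z by (auto simp: Z'_def)
  define M where "M = Max Z'"
  have M: "M \<in> Z'" "\<And>z. z \<in> Z' \<Longrightarrow> z \<le> M"
    using ne by (auto simp: M_def)
  obtain \<epsilon> where \<epsilon>: "\<epsilon> > 0" "\<And>z. z \<in> Z' \<Longrightarrow> z \<noteq> M \<Longrightarrow> \<epsilon> \<le> dist M z"
    using finite_set_avoid[OF ne(1), of M] by blast
  obtain s where s: "s \<in> measure_support G" "\<And>x. x \<in> measure_support G \<Longrightarrow> x \<le> s"
    using compact_attains_sup[OF S measure_support_nonempty[OF G]] by blast
  \<comment> \<open>Every other uncancelled atom lies at least \<open>\<epsilon>\<close> below
    \<open>M\<close>, so its translate of the support ends at or below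
    \<open>M + s - \<epsilon>\<close>.\<close>
  have null: "measure G {\<theta>. z + \<theta> \<in> {M + s - \<epsilon><..}} = 0" if "z \<in> Z'" "z \<noteq> M" for z
  proof -
    have "z \<le> M - \<epsilon>"
      using \<epsilon>(2)[OF that] M(2)[OF that(1)] by (auto simp: dist_real_def)
    then have "AE \<theta> in G. \<not> z + \<theta> > M + s - \<epsilon>"
      using AE_measure_support[OF G.events_eq_borel] s(2) by (auto elim!: eventually_mono) fastforce
    then show ?thesis
      using G.prob_eq_0[of "{\<theta>. z + \<theta> \<in> {M + s - \<epsilon><..}}"] by simp
  qed
  have "0 = (\<Sum>z\<in>Z'. c z * measure G {\<theta>. z + \<theta> \<in> {M + s - \<epsilon><..}})"
    using Z by (subst zero[of "{M + s - \<epsilon><..}", symmetric]) (auto simp: Z'_def intro!: sum.mono_neutral_right)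
  also have "\<dots> = c M * measure G {\<theta>. M + \<theta> \<in> {M + s - \<epsilon><..}}"
    using null M(1) ne(1) by (subst sum.remove[of _ M]) auto
  also have "{\<theta>. M + \<theta> \<in> {M + s - \<epsilon><..}} = {s - \<epsilon><..}"
    by auto
  finally have "measure G {s - \<epsilon><..} = 0"
    using M(1) by (simp add: Z'_def)
  \<comment> \<open>This half-line is an open neighbourhood of the support point
    \<open>s\<close>.\<close>
  moreover have "emeasure G {s - \<epsilon><..} > 0"
    using s(1) \<epsilon>(1) unfolding measure_support_def by auto
  ultimately show False
    by (simp add: G.emeasure_eq_measure)
qed

text \<open>Sending each translate of \<open>H\<close> to the cluster containing it defines
  \<open>\<kappa>\<close>. Each cluster has positive weight and must be hit, so
  \<open>\<kappa>\<close> is onto the finite set \<open>I\<close>, hence bijective, and each cluster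
  is matched with a single translate.\<close>

lemma component_matching:
  fixes m n w v :: "'i \<Rightarrow> real"
  assumes G: "real_distribution G" "compact (measure_support G)"
    and H: "real_distribution H" "compact (measure_support H)"
    and I: "finite I"
    and w: "\<And>i. i \<in> I \<Longrightarrow> w i > 0" "(\<Sum>i\<in>I. w i) = 1"
    and v: "\<And>i. i \<in> I \<Longrightarrow> v i > 0" "(\<Sum>i\<in>I. v i) = 1"
    and sep: "\<And>i j. i \<in> I \<Longrightarrow> j \<in> I \<Longrightarrow> i \<noteq> j \<Longrightarrow> \<bar>m i - m j\<bar> > 2 * diameter (measure_support G)"
    and diam: "diameter (measure_support H) \<le> diameter (measure_support G)"
    and eq: "\<And>E. E \<in> sets borel \<Longrightarrow>
      (\<Sum>i\<in>I. w i * measure G {\<theta>. m i + \<theta> \<in> E}) = (\<Sum>i\<in>I. v i * measure H {\<theta>. n i + \<theta> \<in> E})"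
  shows "\<exists>\<kappa>. bij_betw \<kappa> I I \<and> (\<forall>i\<in>I. v i = w (\<kappa> i)) \<and>
    (\<forall>i\<in>I. \<forall>E\<in>sets borel. measure H {\<theta>. n i + \<theta> \<in> E} = measure G {\<theta>. m (\<kappa> i) + \<theta> \<in> E})"
proof -
  interpret G: real_distribution G by fact
  interpret H: real_distribution H by fact
  define C where "C k = (+) (m k) ` measure_support G" for k
  have C [measurable]: "C k \<in> sets borel" for k
    unfolding C_def using G(2) by (intro borel_closed compact_imp_closed compact_translation)
  have suppG: "AE \<theta> in G. \<theta> \<in> measure_support G" and suppH: "AE \<theta> in H. \<theta> \<in> measure_support H"
    by (auto intro: AE_measure_support)
  have dG: "\<bar>s - s'\<bar> \<le> diameter (measure_support G)"
    if "s \<in> measure_support G" "s' \<in> measure_support G" for s s'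
    using diameter_bounded_bound[OF compact_imp_bounded[OF G(2)] that] by (simp add: dist_real_def)
  have dH: "\<bar>s - s'\<bar> \<le> diameter (measure_support G)"
    if "s \<in> measure_support H" "s' \<in> measure_support H" for s s'
    using diameter_bounded_bound[OF compact_imp_bounded[OF H(2)] that] diam by (simp add: dist_real_def)
  have d0: "diameter (measure_support G) \<ge> 0"
    using diameter_ge_0[OF compact_imp_bounded[OF G(2)]] .
  \<comment> \<open>This explains the factor 2: one diameter absorbs the spread
    \<open>s - s'\<close> inside the clusters, the other the distance from \<open>x\<close> to
    \<open>x'\<close>.\<close>
  have same_cluster: "k = k'"
    if k: "k \<in> I" "k' \<in> I" and x: "x \<in> C k" "x' \<in> C k'"
      and close: "\<bar>x - x'\<bar> \<le> diameter (measure_support G)" for k k' x x'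
  proof (rule ccontr)
    assume "k \<noteq> k'"
    obtain s s' where "s \<in> measure_support G" "x = m k + s" "s' \<in> measure_support G" "x' = m k' + s'"
      using x unfolding C_def by blast
    then show False
      using sep[OF k \<open>k \<noteq> k'\<close>] close dG[of s s'] by linarith
  qed
  have AE_C: "AE \<theta> in G. m k + \<theta> \<in> C k" for k
    using suppG by (auto simp: C_def)
  define U where "U = (\<Union>i\<in>I. C i)"
  have U_borel [measurable]: "U \<in> sets borel"
    using I by (auto simp: U_def)
  have "AE \<theta> in G. m i + \<theta> \<in> U" if "i \<in> I" for i
    using AE_C[of i] that by (auto simp: U_def elim!: eventually_mono)
  then have "measure G {\<theta>. m i + \<theta> \<in> U} = 1" if "i \<in> I" for i
    using G.prob_eq_1[of "{\<theta>. m i + \<theta> \<in> U}"] that by simp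
  then have "(\<Sum>i\<in>I. v i * measure H {\<theta>. n i + \<theta> \<in> U}) = 1"
    using eq[OF U_borel] w(2) by simp
  \<comment> \<open>The missing masses are nonnegative and have positive weights, so a zero total
    forces every translate of \<open>H\<close> to be carried by \<open>U\<close>.\<close>
  then have "(\<Sum>i\<in>I. v i * (1 - measure H {\<theta>. n i + \<theta> \<in> U})) = 0"
    using v(2) by (simp add: right_diff_distrib sum_subtractf)
  then have "\<forall>i\<in>I. v i * (1 - measure H {\<theta>. n i + \<theta> \<in> U}) = 0"
    using I v(1) by (subst (asm) sum_nonneg_eq_0_iff) (auto simp: less_imp_le)
  then have HU: "measure H {\<theta>. n i + \<theta> \<in> U} = 1" if "i \<in> I" for i
    using that v(1)[OF that] by auto
  have "\<exists>k\<in>I. AE \<theta> in H. n i + \<theta> \<in> C k" if "i \<in> I" for i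
  proof -
    have ae: "AE \<theta> in H. \<theta> \<in> measure_support H \<and> n i + \<theta> \<in> U"
      using suppH H.prob_eq_1[of "{\<theta>. n i + \<theta> \<in> U}"] HU[OF that] by simp
    \<comment> \<open>One point of the translate fixes the cluster \<open>k\<close>; all other
      points in the support and in \<open>U\<close> lie within the diameter bound of it and cannot
      be in another cluster.\<close>
    have "\<exists>\<theta>. \<theta> \<in> measure_support H \<and> n i + \<theta> \<in> U"
      using eventually_happens'[OF H.ae_filter_bot ae] .
    then obtain \<theta> k where \<theta>: "\<theta> \<in> measure_support H" "k \<in> I" "n i + \<theta> \<in> C k"
      unfolding U_def by blast
    have "n i + \<theta>' \<in> C k" if "\<theta>' \<in> measure_support H" "n i + \<theta>' \<in> U" for \<theta>'
    proof -
      obtain k' where "k' \<in> I" "n i + \<theta>' \<in> C k'"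
        using \<open>n i + \<theta>' \<in> U\<close> unfolding U_def by blast
      then show ?thesis
        using same_cluster[of k k' "n i + \<theta>" "n i + \<theta>'"] \<theta> dH[OF \<theta>(1) that(1)] by simp
    qed
    then have "AE \<theta> in H. n i + \<theta> \<in> C k"
      by (intro eventually_mono[OF ae]) blast
    then show ?thesis
      using \<theta>(2) by blast
  qed
  then obtain \<kappa> where \<kappa>: "\<And>i. i \<in> I \<Longrightarrow> \<kappa> i \<in> I" "\<And>i. i \<in> I \<Longrightarrow> AE \<theta> in H. n i + \<theta> \<in> C (\<kappa> i)"
    by metis
  \<comment> \<open>Testing the equality of mixtures on \<open>E \<inter> C k\<close> isolates
    component \<open>k\<close> on the left and the fibre of \<open>\<kappa>\<close> over
    \<open>k\<close> on the right.\<close>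
  have key: "w k * measure G {\<theta>. m k + \<theta> \<in> E} = (\<Sum>i | i \<in> I \<and> \<kappa> i = k. v i * measure H {\<theta>. n i + \<theta> \<in> E})"
    if k: "k \<in> I" and E [measurable]: "E \<in> sets borel" for k E
  proof -
    have disj: "x \<notin> C i" if "x \<in> C j" "i \<in> I" "j \<in> I" "i \<noteq> j" for i j x
      using same_cluster[of i j x x] that d0 by auto
    have Gi: "measure G {\<theta>. m i + \<theta> \<in> E \<inter> C k} = (if i = k then measure G {\<theta>. m k + \<theta> \<in> E} else 0)"
      if "i \<in> I" for i
    proof (cases "i = k")
      case True
      have "measure G {\<theta>. m k + \<theta> \<in> E \<inter> C k} = measure G {\<theta>. m k + \<theta> \<in> E}"
        using AE_C[of k] by (intro G.finite_measure_eq_AE) (auto elim!: eventually_mono)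
      then show ?thesis using True by simp
    next
      case False
      have "AE \<theta> in G. \<theta> \<notin> {\<theta>. m i + \<theta> \<in> E \<inter> C k}"
        using AE_C[of i] disj[OF _ k that] False by (auto elim!: eventually_mono)
      then show ?thesis
        using False G.prob_eq_0[of "{\<theta>. m i + \<theta> \<in> E \<inter> C k}"] by simp
    qed
    have Hi: "measure H {\<theta>. n i + \<theta> \<in> E \<inter> C k} = (if \<kappa> i = k then measure H {\<theta>. n i + \<theta> \<in> E} else 0)"
      if "i \<in> I" for i
    proof (cases "\<kappa> i = k")
      case True
      have "measure H {\<theta>. n i + \<theta> \<in> E \<inter> C k} = measure H {\<theta>. n i + \<theta> \<in> E}"
        using \<kappa>(2)[OF that] True by (intro H.finite_measure_eq_AE) (auto elim!: eventually_mono)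
      then show ?thesis using True by simp
    next
      case False
      have "AE \<theta> in H. \<theta> \<notin> {\<theta>. n i + \<theta> \<in> E \<inter> C k}"
        using \<kappa>(2)[OF that] disj[OF _ k \<kappa>(1)[OF that]] False by (auto elim!: eventually_mono)
      then show ?thesis
        using False H.prob_eq_0[of "{\<theta>. n i + \<theta> \<in> E \<inter> C k}"] by simp
    qed
    have "w k * measure G {\<theta>. m k + \<theta> \<in> E} = (\<Sum>i\<in>I. if i = k then w i * measure G {\<theta>. m k + \<theta> \<in> E} else 0)"
      using I k by simp
    also have "\<dots> = (\<Sum>i\<in>I. w i * measure G {\<theta>. m i + \<theta> \<in> E \<inter> C k})"
      using Gi by (intro sum.cong) auto
    also have "\<dots> = (\<Sum>i\<in>I. v i * measure H {\<theta>. n i + \<theta> \<in> E \<inter> C k})"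
      by (intro eq) simp
    also have "\<dots> = (\<Sum>i\<in>I. if \<kappa> i = k then v i * measure H {\<theta>. n i + \<theta> \<in> E} else 0)"
      using Hi by (intro sum.cong) auto
    finally show ?thesis
      using I by (simp add: sum.inter_filter)
  qed
  have wsum: "w k = (\<Sum>i | i \<in> I \<and> \<kappa> i = k. v i)" if "k \<in> I" for k
    using key[OF that, of UNIV] G.prob_space H.prob_space by simp
  \<comment> \<open>An empty fibre would make the positive weight \<open>w k\<close> an empty
    sum.\<close>
  have "k \<in> \<kappa> ` I" if "k \<in> I" for k
  proof (rule ccontr)
    assume "k \<notin> \<kappa> ` I"
    then have empty: "{i. i \<in> I \<and> \<kappa> i = k} = {}" by auto
    show False
      using wsum[OF that] w(1)[OF that] unfolding empty by simp
  qed
  then have surj: "\<kappa> ` I = I"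
    using \<kappa>(1) by auto
  then have inj: "inj_on \<kappa> I"
    using I by (simp add: eq_card_imp_inj_on)
  have fibre: "{j. j \<in> I \<and> \<kappa> j = \<kappa> i} = {i}" if "i \<in> I" for i
    using inj_onD[OF inj] that by auto
  have vw: "v i = w (\<kappa> i)" if "i \<in> I" for i
    using wsum[OF \<kappa>(1)[OF that]] fibre[OF that] by simp
  show ?thesis
  proof (intro exI[of _ \<kappa>] conjI ballI)
    show "bij_betw \<kappa> I I"
      using inj surj by (simp add: bij_betw_def)
    show "v i = w (\<kappa> i)" if "i \<in> I" for i
      using that by (rule vw)
    show "measure H {\<theta>. n i + \<theta> \<in> E} = measure G {\<theta>. m (\<kappa> i) + \<theta> \<in> E}"
      if "i \<in> I" "E \<in> sets borel" for i E
      using key[OF \<kappa>(1)[OF that(1)] that(2)] fibre[OF that(1)] vw[OF that(1)] v(1)[OF that(1)] by simp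
  qed
qed

section \<open>Translations of the error density and its mean\<close>

lemma gauss_conv_translate:
  assumes G: "real_distribution G" and H: "real_distribution H"
    and eq: "\<And>E. E \<in> sets borel \<Longrightarrow> measure H {\<theta>. r + \<theta> \<in> E} = measure G {\<theta>. s + \<theta> \<in> E}"
  shows "gauss_conv \<sigma> H y = gauss_conv \<sigma> G (y - (s - r))"
proof -
  interpret G: real_distribution G by fact
  interpret H: real_distribution H by fact
  have H_eq: "H = distr G borel (\<lambda>\<theta>. (s - r) + \<theta>)"
  proof (rule measure_eqI)
    fix E assume "E \<in> sets H"
    then have [measurable]: "E \<in> sets borel" by simp
    \<comment> \<open>Testing on \<open>E\<close> shifted by \<open>r\<close> cancels the
      translation on the side of \<open>H\<close>.\<close>
    have "(\<lambda>x. x - r) -` E \<inter> space borel \<in> sets borel"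
      by (intro measurable_sets[of _ borel borel]) auto
    then have "measure H E = measure G {\<theta>. (s - r) + \<theta> \<in> E}"
      using eq[of "(\<lambda>x. x - r) -` E"] by (simp add: algebra_simps)
    then show "emeasure H E = emeasure (distr G borel (\<lambda>\<theta>. (s - r) + \<theta>)) E"
      by (simp add: emeasure_distr vimage_def G.emeasure_eq_measure H.emeasure_eq_measure)
  qed simp
  show ?thesis
    unfolding gauss_conv_def
    by (subst H_eq, subst integral_distr) (auto simp: normal_density_def algebra_simps)
qed

text \<open>Translation by \<open>c\<close> raises the mean by \<open>c\<close> times the total mass
  1, so two centred translates coincide.\<close>

lemma centred_translate_eq_0:
  fixes f :: "real \<Rightarrow> real"
  assumes f: "f \<in> borel_measurable borel" "prob_density_on UNIV f"
    and mf: "integrable lebesgue (\<lambda>y. y * f y)" "(LINT y|lebesgue. y * f y) = 0"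
    and mg: "(LINT y|lebesgue. y * f (y - c)) = 0"
  shows "c = 0"
proof -
  note f(1)[measurable]
  have int: "integrable lborel f" "integrable lborel (\<lambda>y. y * f y)"
    using f mf by (auto simp: prob_density_on_def set_integrable_def integrable_completion)
  have one: "(LINT y|lborel. f y) = 1"
    using f(2) by (simp add: prob_density_on_def set_lebesgue_integral_def integral_completion)
  have zero: "(LINT y|lborel. y * f y) = 0"
    using mf(2) by (simp add: integral_completion)
  have "0 = (LINT y|lborel. y * f (y - c))"
    using mg by (simp add: integral_completion)
  also have "\<dots> = (LINT y|lborel. y * f y + c * f y)"
    using lborel_integral_real_affine[of 1 "\<lambda>y. y * f (y - c)" c] by (simp add: algebra_simps)
  also have "\<dots> = c"
    using int one zero by simp
  finally show ?thesis by simp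
qed

subsection \<open>Identifiability\<close>

text \<open>Centring is what removes the translation left undetermined by \<open>component_matching\<close>.\<close>

lemma common_error_density:
  fixes f g :: "real \<Rightarrow> real" and m n w v :: "'i \<Rightarrow> real"
  assumes \<sigma>: "\<sigma> > 0" and I: "finite I"
    and G: "compactly_supported_prob G" "f = gauss_conv \<sigma> G"
    and H: "compactly_supported_prob H" "g = gauss_conv \<sigma> H"
    and f: "prob_density_on UNIV f" "integrable lebesgue (\<lambda>y. y * f y)" "(LINT y|lebesgue. y * f y) = 0"
    and g: "(LINT y|lebesgue. y * g y) = 0"
    and w: "\<And>i. i \<in> I \<Longrightarrow> w i > 0" "(\<Sum>i\<in>I. w i) = 1"
    and v: "\<And>i. i \<in> I \<Longrightarrow> v i > 0" "(\<Sum>i\<in>I. v i) = 1"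
    and sep: "\<And>i j. i \<in> I \<Longrightarrow> j \<in> I \<Longrightarrow> i \<noteq> j \<Longrightarrow> \<bar>m i - m j\<bar> > 2 * diameter (measure_support G)"
    and diam: "diameter (measure_support H) \<le> diameter (measure_support G)"
    and eq: "\<And>y. (\<Sum>i\<in>I. w i * f (y - m i)) = (\<Sum>i\<in>I. v i * g (y - n i))"
  shows "f = g \<and> (\<exists>\<kappa>. bij_betw \<kappa> I I \<and> (\<forall>i\<in>I. v i = w (\<kappa> i)))"
proof -
  have G': "real_distribution G" "compact (measure_support G)"
    and H': "real_distribution H" "compact (measure_support H)"
    using G H by (auto simp: compactly_supported_prob_def intro: real_distributionI)
  have mix: "(\<Sum>i\<in>I. w i * measure G {\<theta>. m i + \<theta> \<in> E}) = (\<Sum>i\<in>I. v i * measure H {\<theta>. n i + \<theta> \<in> E})"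
    if "E \<in> sets borel" for E
    using that I w v G' H' \<sigma> eq[unfolded G(2) H(2)]
    by (intro deconvolution[where \<sigma> = \<sigma>]) (auto simp: less_imp_le)
  obtain \<kappa> where \<kappa>: "bij_betw \<kappa> I I" "\<forall>i\<in>I. v i = w (\<kappa> i)"
    "\<forall>i\<in>I. \<forall>E\<in>sets borel. measure H {\<theta>. n i + \<theta> \<in> E} = measure G {\<theta>. m (\<kappa> i) + \<theta> \<in> E}"
    using component_matching[OF G' H' I w v sep diam mix] by blast
  \<comment> \<open>Weights with sum 1 need a nonempty index set, and one matched pair already
    determines the shift between \<open>f\<close> and \<open>g\<close>.\<close>
  obtain i where "i \<in> I"
    using w(2) by fastforce
  then have tr: "g y = f (y - (m (\<kappa> i) - n i))" for y
    unfolding G(2) H(2) using \<kappa>(3) by (intro gauss_conv_translate[OF G'(1) H'(1)]) simp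
  have "m (\<kappa> i) - n i = 0"
  proof (rule centred_translate_eq_0[OF _ f])
    show "f \<in> borel_measurable borel"
      unfolding G(2) using G'(1) by (rule borel_measurable_gauss_conv)
    show "(LINT y|lebesgue. y * f (y - (m (\<kappa> i) - n i))) = 0"
      using g by (simp add: tr)
  qed
  then show ?thesis
    using tr \<kappa> by auto
qed

text \<open>Integrating the model equation over \<open>y\<close> in this way leaves only the two
  design densities.\<close>

lemma integral_location_mixture:
  fixes f :: "real \<Rightarrow> real"
  assumes f: "f \<in> borel_measurable borel" "prob_density_on UNIV f"
  shows "(LINT y|lborel. (\<Sum>i\<in>I. w i * f (y - m i))) = (\<Sum>i\<in>I. w i)"
proof -
  have int: "integrable lborel f"
    using f by (auto simp: prob_density_on_def set_integrable_def integrable_completion)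
  have one: "(LINT y|lborel. f y) = 1"
    using f by (simp add: prob_density_on_def set_lebesgue_integral_def integral_completion)
  have "integrable lborel (\<lambda>y. f (y - c))" "(LINT y|lborel. f (y - c)) = 1" for c
    using lborel_integrable_real_affine[OF int, of 1 "-c"] lborel_integral_real_affine[of 1 f "-c"] one
    by simp_all
  then show ?thesis
    by simp
qed

text \<open>The set where the functions differ is relatively open; if nonempty, it contains a
  nonempty open subset of the interval, which no countable set can cover.\<close>

lemma continuous_eq_off_countable:
  fixes h k :: "real \<Rightarrow> real"
  assumes "a < b" "continuous_on {a..b} h" "continuous_on {a..b} k" "countable N"
    and eq: "\<And>x. x \<in> {a..b} - N \<Longrightarrow> h x = k x" and x: "x \<in> {a..b}"
  shows "h x = k x"
proof (rule ccontr)
  assume ne: "h x \<noteq> k x"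
  have "continuous_on {a..b} (\<lambda>y. h y - k y)"
    using assms by (intro continuous_intros)
  then obtain T where T: "open T" "T \<inter> {a..b} = (\<lambda>y. h y - k y) -` (- {0}) \<inter> {a..b}"
    by (metis continuous_on_open_invariant open_Compl closed_singleton)
  then have "x \<in> T"
    using ne x by auto
  \<comment> \<open>Since \<open>x\<close> may be an endpoint, it is approached from the open
    interval.\<close>
  moreover have "x \<in> closure {a<..<b}"
    using x \<open>a < b\<close> by simp
  ultimately have "T \<inter> {a<..<b} \<noteq> {}"
    using T(1) open_Int_closure_eq_empty[of T "{a<..<b}"] by blast
  then obtain z where "z \<in> T \<inter> {a<..<b}" "z \<notin> N"
    using open_minus_countable[OF \<open>countable N\<close> _ open_Int[OF T(1) open_greaterThanLessThan]] by blast
  then have "z \<in> {a..b} - N" "z \<in> (\<lambda>y. h y - k y) -` (- {0})"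
    using T(2) by auto
  then show False
    using eq[of z] by auto
qed

theorem theorem6p6:
  fixes a b \<sigma> x0 x1 :: real and K :: nat
    and pX qX f g :: "real \<Rightarrow> real"
    and lam \<pi> :: "nat \<Rightarrow> real"
    and m \<mu> :: "nat \<Rightarrow> real \<Rightarrow> real"
  assumes "a < b" and "K \<ge> 1" and "\<sigma> > 0"
    and "x0 \<in> {a..b}" and "x1 \<in> {a..b}"
    and "(pX, f, lam, m) \<in> regression_class a b K \<sigma> x0"
    and "(qX, g, \<pi>, \<mu>) \<in> regression_class a b K \<sigma> x1"
    and "\<forall>x\<in>{a..b}. \<forall>y.
           pX x * (\<Sum>k=1..K. lam k * f (y - m k x)) = qX x * (\<Sum>k=1..K. \<pi> k * g (y - \<mu> k x))"
  shows "(\<forall>x\<in>{a..b}. pX x = qX x) \<and> f = g \<and>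
         (\<exists>\<tau>. \<tau> permutes {1..K} \<and>
            (\<forall>k\<in>{1..K}. \<pi> k = lam (\<tau> k) \<and> (\<forall>x\<in>{a..b}. \<mu> k x = m (\<tau> k) x)))"
proof -
  define I where "I = {1..K}"
  have I: "finite I" by (simp add: I_def)
  from assms(6) obtain G where p: "prob_density_on {a..b} pX" "(INF x\<in>{a..b}. pX x) > 0"
    and f: "prob_density_on UNIV f" "integrable lebesgue (\<lambda>y. y * f y)" "(LINT y|lebesgue. y * f y) = 0"
    and lam: "\<And>k. k \<in> I \<Longrightarrow> lam k > 0" "(\<Sum>k\<in>I. lam k) = 1"
      "\<And>j k. j \<in> I \<Longrightarrow> k \<in> I \<Longrightarrow> j \<noteq> k \<Longrightarrow> lam j \<noteq> lam k"
    and m: "\<And>k. k \<in> I \<Longrightarrow> continuous_on {a..b} (m k)"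
    and G: "compactly_supported_prob G" "f = gauss_conv \<sigma> G"
    and sepG: "\<And>j k. j \<in> I \<Longrightarrow> k \<in> I \<Longrightarrow> j \<noteq> k \<Longrightarrow> \<bar>m j x0 - m k x0\<bar> > 2 * diameter (measure_support G)"
    and Nm: "countable {x\<in>{a..b}. \<exists>j\<in>I. \<exists>k\<in>I. j \<noteq> k \<and> m j x = m k x}"
    unfolding regression_class_def I_def by auto
  from assms(7) obtain H where
      g: "prob_density_on UNIV g" "integrable lebesgue (\<lambda>y. y * g y)" "(LINT y|lebesgue. y * g y) = 0"
    and pi: "\<And>k. k \<in> I \<Longrightarrow> \<pi> k > 0" "(\<Sum>k\<in>I. \<pi> k) = 1"
    and \<mu>: "\<And>k. k \<in> I \<Longrightarrow> continuous_on {a..b} (\<mu> k)"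
    and H: "compactly_supported_prob H" "g = gauss_conv \<sigma> H"
    and sepH: "\<And>j k. j \<in> I \<Longrightarrow> k \<in> I \<Longrightarrow> j \<noteq> k \<Longrightarrow> \<bar>\<mu> j x1 - \<mu> k x1\<bar> > 2 * diameter (measure_support H)"
    and N\<mu>: "countable {x\<in>{a..b}. \<exists>j\<in>I. \<exists>k\<in>I. j \<noteq> k \<and> \<mu> j x = \<mu> k x}"
    unfolding regression_class_def I_def by auto
  have G': "real_distribution G" "compact (measure_support G)" and H': "real_distribution H"
    using G H by (auto simp: compactly_supported_prob_def intro: real_distributionI)
  have meas: "f \<in> borel_measurable borel" "g \<in> borel_measurable borel"
    using G' H' G H by (auto intro: borel_measurable_gauss_conv)
  have eq: "pX x * (\<Sum>k\<in>I. lam k * f (y - m k x)) = qX x * (\<Sum>k\<in>I. \<pi> k * g (y - \<mu> k x))"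
    if "x \<in> {a..b}" for x y
    using assms(8) that by (simp add: I_def)
  have pq: "pX x = qX x" if x: "x \<in> {a..b}" for x
  proof -
    have "pX x * (LINT y|lborel. (\<Sum>k\<in>I. lam k * f (y - m k x)))
        = qX x * (LINT y|lborel. (\<Sum>k\<in>I. \<pi> k * g (y - \<mu> k x)))"
      unfolding integral_mult_right_zero[symmetric] by (simp only: eq[OF x])
    then show ?thesis
      using lam(2) pi(2) integral_location_mixture[OF meas(1) f(1), of lam "\<lambda>k. m k x" I]
        integral_location_mixture[OF meas(2) g(1), of \<pi> "\<lambda>k. \<mu> k x" I] by simp
  qed
  have pos: "pX x > 0" if "x \<in> {a..b}" for x
  proof -
    \<comment> \<open>On the reals \<open>INF\<close> is a guaranteed lower bound only for sets
      bounded below; nonnegativity provides this.\<close>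
    have "bdd_below (pX ` {a..b})"
      using p(1) by (intro bdd_belowI[of _ 0]) (auto simp: prob_density_on_def)
    then have "(INF x\<in>{a..b}. pX x) \<le> pX x"
      using that by (intro cINF_lower)
    then show ?thesis using p(2) by simp
  qed
  have eq': "(\<Sum>k\<in>I. lam k * f (y - m k x)) = (\<Sum>k\<in>I. \<pi> k * g (y - \<mu> k x))"
    if "x \<in> {a..b}" for x y
    using eq[OF that, of y] pq[OF that] pos[OF that] by simp
  \<comment> \<open>The clusters are separated by twice the diameter of the own error measure only, so the
    matching is carried out at the point belonging to the measure with the wider support.\<close>
  have "f = g \<and> (\<exists>\<kappa>. bij_betw \<kappa> I I \<and> (\<forall>i\<in>I. \<pi> i = lam (\<kappa> i)))"
  proof (cases "diameter (measure_support H) \<le> diameter (measure_support G)")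
    case True
    show ?thesis
      by (rule common_error_density[OF assms(3) I G H f g(3) lam(1,2) pi sepG True eq'[OF assms(4)]])
  next
    case False
    then have le: "diameter (measure_support G) \<le> diameter (measure_support H)"
      by linarith
    have "g = f \<and> (\<exists>\<kappa>. bij_betw \<kappa> I I \<and> (\<forall>i\<in>I. lam i = \<pi> (\<kappa> i)))"
      by (rule common_error_density[OF assms(3) I H G g f(3) pi lam(1,2) sepH le eq'[OF assms(5), symmetric]])
    then obtain \<kappa> where "g = f" and \<kappa>: "bij_betw \<kappa> I I" "\<forall>i\<in>I. lam i = \<pi> (\<kappa> i)"
      by (elim conjE exE)
    \<comment> \<open>The two tuples were exchanged, so the matching has to be inverted.\<close>
    have "\<pi> i = lam (inv_into I \<kappa> i)" if "i \<in> I" for i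
      using \<kappa>(2) bij_betw_inv_into_right[OF \<kappa>(1) that]
        bij_betw_apply[OF bij_betw_inv_into[OF \<kappa>(1)] that] by simp
    then show ?thesis
      using \<open>g = f\<close>[symmetric] bij_betw_inv_into[OF \<kappa>(1)] by blast
  qed
  then obtain \<kappa> where fg: "f = g" and \<kappa>: "bij_betw \<kappa> I I" "\<forall>i\<in>I. \<pi> i = lam (\<kappa> i)"
    by (elim conjE exE)
  define N where "N = {x\<in>{a..b}. \<exists>j\<in>I. \<exists>k\<in>I. j \<noteq> k \<and> m j x = m k x}
    \<union> {x\<in>{a..b}. \<exists>j\<in>I. \<exists>k\<in>I. j \<noteq> k \<and> \<mu> j x = \<mu> k x}"
  have off_N: "\<mu> j x = m (\<kappa> j) x" if x: "x \<in> {a..b} - N" and j: "j \<in> I" for x j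
  proof -
    \<comment> \<open>Deconvolution leaves mixtures of translates of the same \<open>G\<close>,
      which \<open>atoms_unique\<close> cancels.\<close>
    have atoms: "(\<Sum>k | k \<in> I \<and> m k x = z. lam k) = (\<Sum>k | k \<in> I \<and> \<mu> k x = z. \<pi> k)" for z
    proof (rule atoms_unique[OF G' I I])
      fix E :: "real set" assume "E \<in> sets borel"
      then show "(\<Sum>k\<in>I. lam k * measure G {\<theta>. m k x + \<theta> \<in> E}) = (\<Sum>k\<in>I. \<pi> k * measure G {\<theta>. \<mu> k x + \<theta> \<in> E})"
        using assms(3) I lam pi G' eq' x fg
        by (intro deconvolution[where \<sigma> = \<sigma>]) (auto simp: less_imp_le G(2)[symmetric])
    qed
    have "{k. k \<in> I \<and> \<mu> k x = \<mu> j x} = {j}"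
      using x j by (auto simp: N_def)
    then have sum: "(\<Sum>k | k \<in> I \<and> m k x = \<mu> j x. lam k) = \<pi> j"
      by (simp add: atoms)
    \<comment> \<open>The atom at \<open>\<mu> j x\<close> has positive weight
      \<open>\<pi> j\<close>, so some \<open>m k\<close> must pass through it; away from crossings
      only one does.\<close>
    have "{k. k \<in> I \<and> m k x = \<mu> j x} \<noteq> {}"
      using sum pi(1)[OF j] by (metis less_irrefl sum.empty)
    then obtain k where k: "k \<in> I" "m k x = \<mu> j x"
      by blast
    have "i = k" if "i \<in> I" "m i x = \<mu> j x" for i
      using x k that unfolding N_def by force
    then have "{i. i \<in> I \<and> m i x = \<mu> j x} = {k}"
      using k by blast
    then have "lam k = lam (\<kappa> j)"
      using \<kappa>(2) j sum by simp
    \<comment> \<open>Distinct weights identify the index, which makes the matching independent of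
      \<open>x\<close>.\<close>
    then have "k = \<kappa> j"
      using lam(3) k(1) bij_betw_apply[OF \<kappa>(1) j] by blast
    then show ?thesis using k(2) by simp
  qed
  have N: "countable N"
    using Nm N\<mu> by (simp add: N_def)
  have \<mu>_eq: "\<mu> j x = m (\<kappa> j) x" if "x \<in> {a..b}" "j \<in> I" for x j
    by (rule continuous_eq_off_countable[OF assms(1) \<mu>[OF that(2)] m[OF bij_betw_apply[OF \<kappa>(1) that(2)]] N])
       (use off_N that in auto)
  \<comment> \<open>\<open>permutes\<close> demands the identity outside the index set.\<close>
  define \<tau> where "\<tau> k = (if k \<in> I then \<kappa> k else k)" for k
  have "bij_betw \<tau> I I"
    using \<kappa>(1) by (simp add: \<tau>_def cong: bij_betw_cong)
  then have "\<tau> permutes I"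
    by (intro bij_imp_permutes) (auto simp: \<tau>_def)
  then show ?thesis
    using pq fg \<kappa>(2) \<mu>_eq by (auto simp: \<tau>_def I_def intro!: exI[of _ \<tau>])
qed

end
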